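(* For each $p>1$, the metric spaces $\mathcal{D}_{\mathcal{B}}^{<\infty}$ and $\mathcal{D}_{\mathcal{W},p}^{<\infty}$ are not of finite asymptotic dimension; that is, for neither of them does there exist a non-negative integer $m$ such that its asymptotic dimension is at most $m$.
   Context: $\mathbb{N}=\{1,2,\dots\}$. Let $d_\infty((x_1,x_2),(y_1,y_2))=\max\{|x_1-y_1|,|x_2-y_2|\}$ on $\mathbb{R}^2$, let $T=\{(x_1,x_2)\in\mathbb{R}^2 \mid x_2>x_1\ge 0\}$, let $\Delta\notin T$ be an extra point (representing the diagonal), and put $\mathcal{D}^1=T\cup\{\Delta\}$. Define the semi-metric $\delta$ on $\mathcal{D}^1$ by $\delta=d_\infty$ on $T$, $\delta((x_1,x_2),\Delta)=\delta(\Delta,(x_1,x_2))=(x_2-x_1)/2$, $\delta(\Delta,\Delta)=0$. For $n\in\mathbb{N}$, the space of persistence diagrams on at most $n$ points is the set $\mathcal{D}^n=(\mathcal{D}^1)^n/\mathcal{S}_n$, where the symmetric group $\mathcal{S}_n$ permutes coordinates. Appending $\Delta$ gives a natural inclusion $\mathcal{D}^n\subset\mathcal{D}^{n+1}$, and $\mathcal{D}^{<\infty}=\bigcup_{n\in\mathbb{N}}\mathcal{D}^n$. For $z=(z_1,\dots,z_n)$, $z'=(z_1',\dots,z_n')$ in $\mathcal{D}^n$, put $z_i=z_i'=\Delta$ for $n<i\le 2n$ and define $$d_{\mathcal{B}}(z,z')=\min_{\varphi\in\mathcal{S}_{2n}}\max_{1\le i\le 2n}\delta(z_i,z'_{\varphi(i)}),\qquad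 d_{\mathcal{W},p}(z,z')=\min_{\varphi\in\mathcal{S}_{2n}}\Big(\sum_{i=1}^{2n}\delta(z_i,z'_{\varphi(i)})^p\Big)^{1/p}$$ (the bottleneck and the $p$-Wasserstein distance). These are compatible with the inclusions, so they define metrics on $\mathcal{D}^{<\infty}$; set $\mathcal{D}_{\mathcal{B}}^{<\infty}=(\mathcal{D}^{<\infty},d_{\mathcal{B}})$ and $\mathcal{D}_{\mathcal{W},p}^{<\infty}=(\mathcal{D}^{<\infty},d_{\mathcal{W},p})$. For a non-negative integer $m$, a metric space $X$ has asymptotic dimension at most $m$ iff for every $R>0$, $X$ is the union of $m+1$ subsets $X_0,\dots,X_m$, each $X_i$ being the union of a family of uniformly bounded, $R$-disjoint sets (uniformly bounded: the diameters of the members have a common finite upper bound; $R$-disjoint: distinct members are at distance at least $R$). *)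

theory Defs
  imports Complex_Main "HOL-Combinatorics.Permutations"
begin

section \<open>The space of persistence diagrams on one point\<close>

typedef offdiag = "{x :: real \<times> real. 0 \<le> fst x \<and> fst x < snd x}"
  by (rule exI[of _ "(0, 1)"]) simp

datatype dpoint = Off offdiag | Diag  (\<open>\<Delta>\<close>)

definition d_infty :: "real \<times> real \<Rightarrow> real \<times> real \<Rightarrow> real" where
  "d_infty x y = max \<bar>fst x - fst y\<bar> \<bar>snd x - snd y\<bar>"

fun delta :: "dpoint \<Rightarrow> dpoint \<Rightarrow> real" where
  "delta (Off x) (Off y) = d_infty (Rep_offdiag x) (Rep_offdiag y)"
| "delta (Off x) \<Delta> = (snd (Rep_offdiag x) - fst (Rep_offdiag x)) / 2"
| "delta \<Delta> (Off y) = (snd (Rep_offdiag y) - fst (Rep_offdiag y)) / 2"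
| "delta \<Delta> \<Delta> = 0"

section \<open>The bottleneck and Wasserstein distances of tuples\<close>

text \<open>A list of length \<open>n \<ge> 1\<close> is a representative of an element of the space of diagrams on at
  most \<open>n\<close> points. Beyond its length a tuple is continued by \<open>\<Delta>\<close>; this covers both the inclusion
  into diagrams on more points and the padding to length \<open>2n\<close> in the definition of the distances.
  Indices start at \<open>0\<close>.\<close>

definition entry :: "dpoint list \<Rightarrow> nat \<Rightarrow> dpoint" where
  "entry z i = (if i < length z then z ! i else \<Delta>)"

definition bottleneck_list :: "dpoint list \<Rightarrow> dpoint list \<Rightarrow> real" where
  "bottleneck_list z z' = (let n = max (length z) (length z') in
     Min ((\<lambda>\<phi>. Max ((\<lambda>i. delta (entry z i) (entry z' (\<phi> i))) ` {..<2 * n}))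
       ` {\<phi>. \<phi> permutes {..<2 * n}}))"

definition wasserstein_list :: "real \<Rightarrow> dpoint list \<Rightarrow> dpoint list \<Rightarrow> real" where
  "wasserstein_list p z z' = (let n = max (length z) (length z') in
     Min ((\<lambda>\<phi>. (\<Sum>i<2 * n. delta (entry z i) (entry z' (\<phi> i)) powr p) powr (1 / p))
       ` {\<phi>. \<phi> permutes {..<2 * n}}))"

section \<open>The distances depend only on the represented diagram\<close>

text \<open>Two nonempty tuples represent the same diagram iff they agree up to a permutation of
  coordinates once enough copies of \<open>\<Delta>\<close> have been appended to each.\<close>

definition same_diagram :: "dpoint list \<Rightarrow> dpoint list \<Rightarrow> bool" where
  "same_diagram z z' \<longleftrightarrow> z \<noteq> [] \<and> z' \<noteq> [] \<and>
     (\<exists>a b. mset (z @ replicate a \<Delta>) = mset (z' @ replicate b \<Delta>))"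

definition padded :: "nat \<Rightarrow> dpoint list \<Rightarrow> dpoint multiset" where
  "padded N z = mset (map (entry z) [0..<N])"

definition costs :: "nat \<Rightarrow> dpoint list \<Rightarrow> dpoint list \<Rightarrow> real multiset set" where
  "costs N z w = (\<lambda>\<phi>. image_mset (\<lambda>i. delta (entry z i) (entry w (\<phi> i))) (mset_set {..<N}))
     ` {\<phi>. \<phi> permutes {..<N}}"

definition couplings :: "dpoint multiset \<Rightarrow> dpoint multiset \<Rightarrow> (dpoint \<times> dpoint) multiset set" where
  "couplings A B = {M. image_mset fst M = A \<and> image_mset snd M = B}"

definition coupling_costs :: "dpoint multiset \<Rightarrow> dpoint multiset \<Rightarrow> real multiset set" where
  "coupling_costs A B = image_mset (\<lambda>(x, y). delta x y) ` couplings A B"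

lemma delta_nonneg: "0 \<le> delta x y"
proof (cases "(x, y)" rule: delta.cases)
  case (2 u)
  then show ?thesis using Rep_offdiag[of u] by simp
next
  case (3 u)
  then show ?thesis using Rep_offdiag[of u] by simp
qed (auto simp: d_infty_def)

lemma padded_eq:
  assumes "length z \<le> N"
  shows "padded N z = mset (z @ replicate (N - length z) \<Delta>)"
proof -
  have "map (entry z) [0..<N] = z @ replicate (N - length z) \<Delta>"
    using assms by (intro nth_equalityI) (auto simp: entry_def nth_append)
  then show ?thesis by (simp add: padded_def)
qed

lemma costs_eq: "costs N z w = coupling_costs (padded N z) (padded N w)"
proof (intro equalityI subsetI)
  fix c assume "c \<in> costs N z w"
  then obtain \<phi> where \<phi>: "\<phi> permutes {..<N}"
    and c: "c = image_mset (\<lambda>i. delta (entry z i) (entry w (\<phi> i))) (mset_set {..<N})"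
    by (auto simp: costs_def)
  define M where "M = image_mset (\<lambda>i. (entry z i, entry w (\<phi> i))) (mset_set {..<N})"
  have ivl: "mset [0..<N] = mset_set {..<N}"
    by (simp add: atLeast0LessThan)
  have "image_mset \<phi> (mset_set {..<N}) = mset_set {..<N}"
    using \<phi> by (simp add: image_mset_mset_set permutes_inj_on permutes_image)
  then have "image_mset snd M = image_mset (entry w) (mset_set {..<N})"
    by (metis (no_types, lifting) M_def multiset.map_comp multiset.map_cong0 comp_apply snd_conv)
  moreover have "image_mset fst M = image_mset (entry z) (mset_set {..<N})"
    by (simp add: M_def multiset.map_comp comp_def)
  moreover have "c = image_mset (\<lambda>(x, y). delta x y) M"
    by (simp add: c M_def multiset.map_comp comp_def)
  ultimately show "c \<in> coupling_costs (padded N z) (padded N w)"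
    using ivl by (auto simp: coupling_costs_def couplings_def padded_def simp flip: ivl)
next
  fix c assume "c \<in> coupling_costs (padded N z) (padded N w)"
  then obtain M where M: "image_mset fst M = padded N z" "image_mset snd M = padded N w"
    and c: "c = image_mset (\<lambda>(x, y). delta x y) M"
    by (auto simp: coupling_costs_def couplings_def)
  obtain L where L: "mset L = M" using ex_mset by blast
  have "mset (map (entry z) [0..<N]) = mset (map fst L)"
    using M(1) L by (simp add: padded_def)
  then obtain q where q: "q permutes {..<length (map fst L)}"
    "permute_list q (map fst L) = map (entry z) [0..<N]"
    by (rule mset_eq_permutation)
  define K where "K = permute_list q L"
  have K: "mset K = M" "map fst K = map (entry z) [0..<N]"
    using q L by (auto simp: K_def permute_list_map)
  have len: "length K = N" using arg_cong[OF K(2), of length] by simp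
  have "mset (map snd K) = mset (map (entry w) [0..<N])"
    using M(2) K by (simp add: padded_def)
  then obtain \<phi> where \<phi>': "\<phi> permutes {..<length (map (entry w) [0..<N])}"
    "permute_list \<phi> (map (entry w) [0..<N]) = map snd K"
    by (rule mset_eq_permutation)
  have \<phi>: "\<phi> permutes {..<N}" using \<phi>'(1) by simp
  have *: "K ! i = (entry z i, entry w (\<phi> i))" if "i < N" for i
  proof (rule prod_eqI)
    have "map fst K ! i = entry z i" using K(2) that by simp
    then show "fst (K ! i) = fst (entry z i, entry w (\<phi> i))" using that len by simp
    have "\<phi> i < N" using permutes_in_image[OF \<phi>, of i] that by simp
    moreover have "map snd K ! i = map (entry w) [0..<N] ! \<phi> i"
      using \<phi>' that by (metis length_map length_upt minus_nat.diff_0 permute_list_nth)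
    ultimately show "snd (K ! i) = snd (entry z i, entry w (\<phi> i))" using that len by simp
  qed
  have "K = map (\<lambda>i. (entry z i, entry w (\<phi> i))) [0..<N]"
    by (rule nth_equalityI) (simp_all add: len *)
  then have "M = image_mset (\<lambda>i. (entry z i, entry w (\<phi> i))) (mset_set {..<N})"
    using K(1) by (metis atLeast0LessThan mset_map mset_upt)
  then have "c = image_mset (\<lambda>i. delta (entry z i) (entry w (\<phi> i))) (mset_set {..<N})"
    by (simp add: c multiset.map_comp comp_def)
  then show "c \<in> costs N z w" using \<phi> by (auto simp: costs_def)
qed

lemma coupling_costs_add_Diag:
  assumes "size A < count A \<Delta> + count B \<Delta> + 1"
  shows "coupling_costs (add_mset \<Delta> A) (add_mset \<Delta> B) = add_mset 0 ` coupling_costs A B"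
proof (intro equalityI subsetI)
  fix c assume "c \<in> coupling_costs (add_mset \<Delta> A) (add_mset \<Delta> B)"
  then obtain M where M: "image_mset fst M = add_mset \<Delta> A" "image_mset snd M = add_mset \<Delta> B"
    and c: "c = image_mset (\<lambda>(x, y). delta x y) M"
    by (auto simp: coupling_costs_def couplings_def)
  have "(\<Delta>, \<Delta>) \<in># M"
  proof (rule ccontr)
    assume no: "(\<Delta>, \<Delta>) \<notin># M"
    have "count (image_mset fst M) \<Delta> = size (filter_mset (\<lambda>u. fst u = \<Delta>) M)"
      by (simp add: count_image_mset' filter_mset_eq_conv size_multiset_overloaded_eq)
        (auto intro!: sum.cong)
    moreover have "count (image_mset snd M) \<Delta> = size (filter_mset (\<lambda>u. snd u = \<Delta>) M)"
      by (simp add: count_image_mset' size_multiset_overloaded_eq) (auto intro!: sum.cong)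
    moreover have "filter_mset (\<lambda>u. snd u = \<Delta>) M \<subseteq># filter_mset (\<lambda>u. fst u \<noteq> \<Delta>) M"
      using no by (intro filter_mset_mono_strong) (auto simp: prod_eq_iff)
    moreover have "size M = size (filter_mset (\<lambda>u. fst u = \<Delta>) M) + size (filter_mset (\<lambda>u. fst u \<noteq> \<Delta>) M)"
      by (metis multiset_partition size_union)
    ultimately have "count (image_mset fst M) \<Delta> + count (image_mset snd M) \<Delta> \<le> size M"
      using size_mset_mono by fastforce
    moreover have "size M = Suc (size A)" using M(1) by (metis size_add_mset size_image_mset)
    ultimately show False using assms M by simp
  qed
  then obtain M' where M': "M = add_mset (\<Delta>, \<Delta>) M'" by (metis insert_DiffM)
  then show "c \<in> add_mset 0 ` coupling_costs A B"
    using M c by (auto simp: coupling_costs_def couplings_def)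
next
  fix c assume "c \<in> add_mset 0 ` coupling_costs A B"
  then obtain M where M: "image_mset fst M = A" "image_mset snd M = B"
    and c: "c = add_mset 0 (image_mset (\<lambda>(x, y). delta x y) M)"
    by (auto simp: coupling_costs_def couplings_def)
  show "c \<in> coupling_costs (add_mset \<Delta> A) (add_mset \<Delta> B)"
    unfolding coupling_costs_def couplings_def
    by (rule image_eqI[of _ _ "add_mset (\<Delta>, \<Delta>) M"]) (simp_all add: M c)
qed

lemma padded_Suc: "length z \<le> N \<Longrightarrow> padded (Suc N) z = add_mset \<Delta> (padded N z)"
  by (simp add: padded_def entry_def)

lemma costs_nonneg: "c \<in> costs N z w \<Longrightarrow> x \<in># c \<Longrightarrow> 0 \<le> x"
  by (auto simp: costs_def delta_nonneg)

lemma costs_size: "c \<in> costs N z w \<Longrightarrow> size c = N"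
  by (auto simp: costs_def)

lemma costs_Suc:
  assumes "2 * max (length z) (length w) \<le> N"
  shows "costs (Suc N) z w = add_mset 0 ` costs N z w"
proof -
  have "size (padded N z) = N" by (simp add: padded_def)
  moreover have "N - length v \<le> count (padded N v) \<Delta>" if "length v \<le> N" for v
    using that by (simp add: padded_eq)
  moreover have *: "2 * length z \<le> N" "2 * length w \<le> N"
    using assms by auto
  ultimately have "N - length z \<le> count (padded N z) \<Delta>" "N - length w \<le> count (padded N w) \<Delta>"
    by auto
  then have "size (padded N z) < count (padded N z) \<Delta> + count (padded N w) \<Delta> + 1"
    using * \<open>size (padded N z) = N\<close> by linarith
  then show ?thesis
    using * by (simp add: costs_eq padded_Suc coupling_costs_add_Diag)
qed

lemma Min_costs_eq:
  fixes F :: "real multiset \<Rightarrow> real"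
  assumes "\<And>c. c \<noteq> {#} \<Longrightarrow> (\<And>x. x \<in># c \<Longrightarrow> 0 \<le> x) \<Longrightarrow> F (add_mset 0 c) = F c"
    and "z \<noteq> []" and "2 * max (length z) (length w) \<le> N"
  shows "Min (F ` costs N z w) = Min (F ` costs (2 * max (length z) (length w)) z w)"
  using assms(3)
proof (induction N rule: dec_induct)
  case (step N)
  have "0 < length z" "length z \<le> N" using step(1) \<open>z \<noteq> []\<close> by auto
  then have "N \<noteq> 0" by linarith
  then have "F (add_mset 0 c) = F c" if "c \<in> costs N z w" for c
    using costs_size[OF that] costs_nonneg[OF that] by (intro assms(1)) auto
  then have "F ` costs (Suc N) z w = F ` costs N z w"
    using step(1) by (simp add: costs_Suc image_image)
  then show ?case using step by simp
qed simp

lemma Min_costs_cong: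
  fixes F :: "real multiset \<Rightarrow> real"
  assumes F: "\<And>c. c \<noteq> {#} \<Longrightarrow> (\<And>x. x \<in># c \<Longrightarrow> 0 \<le> x) \<Longrightarrow> F (add_mset 0 c) = F c"
    and "same_diagram z z'" and "same_diagram w w'"
  shows "Min (F ` costs (2 * max (length z) (length w)) z w) =
    Min (F ` costs (2 * max (length z') (length w')) z' w')"
proof -
  define N where "N = 2 * max (max (length z) (length w)) (max (length z') (length w'))"
  have *: "padded N v = padded N v'"
    if same: "same_diagram v v'" and l: "length v \<le> N" "length v' \<le> N" for v v'
  proof -
    obtain a b where ab: "mset v + replicate_mset a \<Delta> = mset v' + replicate_mset b \<Delta>"
      using same by (auto simp: same_diagram_def)
    have "length v + a = length v' + b" using arg_cong[OF ab, of size] by simp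
    show ?thesis
    proof (rule multiset_eqI)
      fix x
      show "count (padded N v) x = count (padded N v') x"
        using arg_cong[OF ab, of "\<lambda>M. count M x"] \<open>length v + a = length v' + b\<close> l
        by (auto simp: padded_eq split: if_splits)
    qed
  qed
  have "length z \<le> N" "length z' \<le> N" "length w \<le> N" "length w' \<le> N"
    by (auto simp: N_def)
  then have "costs N z w = costs N z' w'"
    unfolding costs_eq using assms(2,3) *[of z z'] *[of w w'] by simp
  moreover have "z \<noteq> []" "z' \<noteq> []" using assms(2) by (auto simp: same_diagram_def)
  ultimately show ?thesis
    using Min_costs_eq[of F z w N] Min_costs_eq[of F z' w' N] F by (simp add: N_def)
qed

lemma bottleneck_list_eq:
  "bottleneck_list z w =
     Min ((\<lambda>c. Max (set_mset c)) ` costs (2 * max (length z) (length w)) z w)"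
  by (simp add: bottleneck_list_def costs_def image_image Let_def)

lemma wasserstein_list_eq:
  "wasserstein_list p z w =
     Min ((\<lambda>c. (\<Sum>x\<in>#c. x powr p) powr (1 / p)) ` costs (2 * max (length z) (length w)) z w)"
  by (simp add: wasserstein_list_def costs_def image_image Let_def sum_unfold_sum_mset
      multiset.map_comp comp_def)

lemma bottleneck_list_cong:
  assumes "same_diagram z z'" and "same_diagram w w'"
  shows "bottleneck_list z w = bottleneck_list z' w'"
  unfolding bottleneck_list_eq
proof (rule Min_costs_cong[OF _ assms])
  fix c :: "real multiset"
  assume c: "c \<noteq> {#}" "\<And>x. x \<in># c \<Longrightarrow> 0 \<le> x"
  then have "0 \<le> Max (set_mset c)"
    by (metis Max_in finite_set_mset set_mset_eq_empty_iff)
  then show "Max (set_mset (add_mset 0 c)) = Max (set_mset c)"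
    using c(1) by (simp add: max_def)
qed

lemma wasserstein_list_cong:
  assumes "same_diagram z z'" and "same_diagram w w'"
  shows "wasserstein_list p z w = wasserstein_list p z' w'"
  unfolding wasserstein_list_eq by (rule Min_costs_cong[OF _ assms]) simp

section \<open>Persistence diagrams on finitely many points\<close>

lemma part_equivp_same_diagram: "part_equivp same_diagram"
proof (rule part_equivpI)
  show "\<exists>z. same_diagram z z"
    by (rule exI[of _ "[\<Delta>]"]) (auto simp: same_diagram_def)
  show "symp same_diagram"
    by (rule sympI) (metis same_diagram_def)
  show "transp same_diagram"
  proof (rule transpI)
    fix x y z assume "same_diagram x y" "same_diagram y z"
    then obtain a b c d where ne: "x \<noteq> []" "z \<noteq> []"
      and 1: "mset x + replicate_mset a \<Delta> = mset y + replicate_mset b \<Delta>"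
      and 2: "mset y + replicate_mset c \<Delta> = mset z + replicate_mset d \<Delta>"
      by (auto simp: same_diagram_def)
    have "mset x + replicate_mset (a + c) \<Delta> = mset z + replicate_mset (d + b) \<Delta>"
    proof (rule multiset_eqI)
      fix u
      show "count (mset x + replicate_mset (a + c) \<Delta>) u = count (mset z + replicate_mset (d + b) \<Delta>) u"
        using arg_cong[OF 1, of "\<lambda>M. count M u"] arg_cong[OF 2, of "\<lambda>M. count M u"]
        by (auto split: if_splits)
    qed
    then show "same_diagram x z"
      unfolding same_diagram_def using ne by (metis mset_append mset_replicate)
  qed
qed

quotient_type diagram = "dpoint list" / partial: same_diagram
  by (rule part_equivp_same_diagram)

lift_definition bottleneck :: "diagram \<Rightarrow> diagram \<Rightarrow> real" is bottleneck_list
  by (rule bottleneck_list_cong)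

lift_definition wasserstein :: "real \<Rightarrow> diagram \<Rightarrow> diagram \<Rightarrow> real" is wasserstein_list
  by (rule wasserstein_list_cong)

section \<open>Asymptotic dimension\<close>

definition uniformly_bounded_family :: "('a \<Rightarrow> 'a \<Rightarrow> real) \<Rightarrow> 'a set set \<Rightarrow> bool" where
  "uniformly_bounded_family d \<F> \<longleftrightarrow> (\<exists>b. \<forall>S\<in>\<F>. \<forall>x\<in>S. \<forall>y\<in>S. d x y \<le> b)"

definition R_disjoint_family :: "('a \<Rightarrow> 'a \<Rightarrow> real) \<Rightarrow> real \<Rightarrow> 'a set set \<Rightarrow> bool" where
  "R_disjoint_family d R \<F> \<longleftrightarrow>
     (\<forall>S\<in>\<F>. \<forall>S'\<in>\<F>. S \<noteq> S' \<longrightarrow> (\<forall>x\<in>S. \<forall>y\<in>S'. R \<le> d x y))"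

definition asdim_le :: "'a set \<Rightarrow> ('a \<Rightarrow> 'a \<Rightarrow> real) \<Rightarrow> nat \<Rightarrow> bool" where
  "asdim_le M d m \<longleftrightarrow> (\<forall>R>0. \<exists>X :: nat \<Rightarrow> 'a set. M = (\<Union>i\<le>m. X i) \<and>
     (\<forall>i\<le>m. \<exists>\<F>. X i = \<Union>\<F> \<and> uniformly_bounded_family d \<F> \<and> R_disjoint_family d R \<F>))"

end

theory Submission
  imports Defs "HOL-Analysis.Brouwer_Fixpoint"
begin

text \<open>Finite asymptotic dimension fails because the diagrams contain arbitrarily large boxes of the
  grid \<open>\<nat>\<^sup>n\<close> for every \<open>n\<close>. Moving the death coordinates of \<open>n\<close> off-diagonal points independently,
  while the points stay far from each other and from the diagonal, gives a copy of \<open>{0..L}\<^sup>n\<close> inside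
  the diagrams on \<open>n\<close> points: no matching of two such diagrams is cheaper at a point than the identity, so a
  coordinate difference is a lower bound for the distance, while points of the grid that are close
  in the maximum metric have distance bounded in terms of \<open>n\<close> and \<open>p\<close> only, independently of \<open>L\<close>
  (lemmas \<open>coordinate_le_delta\<close>, \<open>grid_list_bottleneck_bounds\<close> and
  \<open>grid_list_wasserstein_bounds\<close>).

  For fixed \<open>n\<close> and arbitrarily large \<open>L\<close>, such boxes obstruct asymptotic dimension at most
  \<open>n - 1\<close>, as in Lebesgue's covering theorem: if a large cube is covered by \<open>n\<close> colours, then for some \<open>i\<close> the colour \<open>i\<close> has a coarsely connected
  piece reaching from the face \<open>x\<^sub>i = 0\<close> to the opposite face, whereas a uniformly bounded,
  \<open>R\<close>-disjoint family has no long pieces. The topological input is Kuhn's combinatorial form of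
  Brouwer's theorem, and lemma \<open>not_asdim_le_of_boxes\<close> derives the obstruction from it.\<close>

text \<open>The \<open>m + 1\<close> colours of the covering are paired with the \<open>m + 1\<close> coordinates. The label \<open>0\<close> in
  coordinate \<open>i\<close> marks the points on the face \<open>x\<^sub>i = 0\<close> or next to a piece of colour \<open>i\<close>
  that starts on this face. Bounded pieces never come near the opposite face, so Kuhn's lemma yields
  a unit cube in which every label takes both values. Its lowest corner \<open>q\<close> has some colour \<open>i\<close>.
  The label \<open>1\<close> in coordinate \<open>i\<close> keeps \<open>q\<close> out of the pieces of colour \<open>i\<close> starting on
  the face; the label \<open>0\<close> puts \<open>q\<close> on the face or at grid distance at most \<open>2\<close> from such a piece,
  and disjointness then forces \<open>q\<close> into it.\<close>

lemma not_asdim_le_of_boxes: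
  fixes d :: "'a \<Rightarrow> 'a \<Rightarrow> real" and M :: "'a set" and m :: nat and C :: real
  assumes boxes: "\<And>L. 0 < L \<Longrightarrow> \<exists>f :: (nat \<Rightarrow> nat) \<Rightarrow> 'a. \<forall>x. (\<forall>i\<le>m. x i \<le> L) \<longrightarrow>
    f x \<in> M \<and> (\<forall>y. (\<forall>i\<le>m. y i \<le> L) \<longrightarrow>
      (\<forall>i\<le>m. \<bar>real (x i) - real (y i)\<bar> \<le> d (f x) (f y)) \<and>
      ((\<forall>i\<le>m. \<bar>real (x i) - real (y i)\<bar> \<le> 2) \<longrightarrow> d (f x) (f y) \<le> C))"
  shows "\<not> asdim_le M d m"
proof
  assume asdim: "asdim_le M d m"
  \<comment> \<open>Any scale above \<open>C\<close> keeps points of different pieces of one colour more than two grid steps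
    apart in some coordinate.\<close>
  have R: "0 < max 0 C + 1" by simp
  obtain X where cover: "M = (\<Union>i\<le>m. X i)"
    and X: "\<And>i. i \<le> m \<Longrightarrow> \<exists>\<F>. X i = \<Union>\<F> \<and> uniformly_bounded_family d \<F> \<and>
      R_disjoint_family d (max 0 C + 1) \<F>"
    using asdim[unfolded asdim_le_def, rule_format, OF R] by blast
  obtain F where F: "\<And>i. i \<le> m \<Longrightarrow> X i = \<Union>(F i)"
    and bdd: "\<And>i. i \<le> m \<Longrightarrow> uniformly_bounded_family d (F i)"
    and disj: "\<And>i. i \<le> m \<Longrightarrow> R_disjoint_family d (max 0 C + 1) (F i)"
    using X by metis
  obtain b where b: "\<And>i S x y. i \<le> m \<Longrightarrow> S \<in> F i \<Longrightarrow> x \<in> S \<Longrightarrow> y \<in> S \<Longrightarrow> d x y \<le> b i"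
    using bdd unfolding uniformly_bounded_family_def by metis
  define B where "B = (\<Sum>i\<le>m. \<bar>b i\<bar>)"
  have bB: "b i \<le> B" if "i \<le> m" for i
    using member_le_sum[of i "{..m}" "\<lambda>i. \<bar>b i\<bar>"] that by (simp add: B_def)
  \<comment> \<open>A piece that starts on a face stays within \<open>B\<close> of it; a neighbour of such a piece reaches
    at most \<open>B + 1\<close>, so \<open>B + 1 < L\<close> keeps it off the opposite face.\<close>
  define L where "L = nat \<lceil>B\<rceil> + 2"
  have L: "B + 1 < real L" "0 < L"
    unfolding L_def by linarith+
  define box where "box x \<longleftrightarrow> (\<forall>i\<le>m. x i \<le> L)" for x :: "nat \<Rightarrow> nat"
  obtain f :: "(nat \<Rightarrow> nat) \<Rightarrow> 'a"
    where fM: "\<And>x. box x \<Longrightarrow> f x \<in> M"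
    and lower: "\<And>x y i. box x \<Longrightarrow> box y \<Longrightarrow> i \<le> m \<Longrightarrow> \<bar>real (x i) - real (y i)\<bar> \<le> d (f x) (f y)"
    and upper: "\<And>x y. box x \<Longrightarrow> box y \<Longrightarrow> (\<And>i. i \<le> m \<Longrightarrow> \<bar>real (x i) - real (y i)\<bar> \<le> 2) \<Longrightarrow>
      d (f x) (f y) \<le> C"
    using boxes[OF L(2)] unfolding box_def by blast
  define start where "start i y \<longleftrightarrow>
    box y \<and> (\<exists>S\<in>F i. f y \<in> S \<and> (\<exists>z. box z \<and> f z \<in> S \<and> z i = 0))" for i and y :: "nat \<Rightarrow> nat"
  define near where "near x y \<longleftrightarrow> (\<forall>j\<le>m. \<bar>real (x j) - real (y j)\<bar> \<le> 1)" for x y :: "nat \<Rightarrow> nat"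
  define label where "label x i = (if x i = 0 \<or> (\<exists>y. start i y \<and> near x y) then 0 else 1 :: nat)"
    for x i
  have start_low: "real (y i) \<le> B" if "start i y" "i \<le> m" for i y
  proof -
    obtain S z where S: "S \<in> F i" "f y \<in> S" "box z" "f z \<in> S" "z i = 0" "box y"
      using \<open>start i y\<close> by (auto simp: start_def)
    have "real (y i) \<le> d (f y) (f z)" using lower[of y z i] S that by simp
    also have "\<dots> \<le> b i" using b S that by blast
    finally show ?thesis using bB[OF that(2)] by linarith
  qed
  have label1: "label x i = 1" if "x i = L" "i \<le> m" for x i
  proof -
    have "\<not> near x y" if "start i y" for y
      using start_low[OF that \<open>i \<le> m\<close>] L \<open>x i = L\<close> \<open>i \<le> m\<close> by (force simp: near_def)
    then show ?thesis using L that by (auto simp: label_def)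
  qed
  obtain q where q: "\<And>i. i \<le> m \<Longrightarrow> q i < L"
    and cell: "\<And>i. i \<le> m \<Longrightarrow> \<exists>r s. (\<forall>j\<le>m. q j \<le> r j \<and> r j \<le> q j + 1) \<and>
      (\<forall>j\<le>m. q j \<le> s j \<and> s j \<le> q j + 1) \<and> label r i \<noteq> label s i"
  proof (rule kuhn_lemma[of L "Suc m" label])
    show "0 < L" by (fact L)
  next
    fix q assume "\<forall>i<Suc m. q i < L" and "\<forall>i<Suc m. \<exists>r s.
      (\<forall>j<Suc m. q j \<le> r j \<and> r j \<le> q j + 1) \<and> (\<forall>j<Suc m. q j \<le> s j \<and> s j \<le> q j + 1) \<and>
      label r i \<noteq> label s i"
    then show thesis
      by (intro that[of q]) (auto simp: less_Suc_eq_le)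
  next
    show "\<forall>x. (\<forall>i<Suc m. x i \<le> L) \<longrightarrow> (\<forall>i<Suc m. x i = L \<longrightarrow> label x i = 1)"
      by (simp add: label1 less_Suc_eq_le)
  qed (simp_all add: label_def)
  have boxq: "box q" using q by (auto simp: box_def intro: less_imp_le)
  then obtain i S where i: "i \<le> m" and S: "S \<in> F i" "f q \<in> S"
    using fM[OF boxq] cover F by auto
  obtain r s where r: "\<And>j. j \<le> m \<Longrightarrow> q j \<le> r j \<and> r j \<le> q j + 1"
    and s: "\<And>j. j \<le> m \<Longrightarrow> q j \<le> s j \<and> s j \<le> q j + 1"
    and label: "label r i = 0" "label s i = 1"
    using cell[OF i] by (metis label_def)
  have "near s q" using s by (fastforce simp: near_def)
  then have no_start: "\<not> start i q" using label(2) by (auto simp: label_def split: if_splits)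
  consider "r i = 0" | y where "start i y" "near r y"
    using label(1) by (auto simp: label_def split: if_splits)
  then show False
  proof cases
    case 1
    then have "q i = 0" using r[OF i] by simp
    then have "start i q" using S boxq by (auto simp: start_def)
    then show False using no_start by simp
  next
    case 2
    obtain S' z where S': "box y" "S' \<in> F i" "f y \<in> S'" "box z" "f z \<in> S'" "z i = 0"
      using 2(1) by (auto simp: start_def)
    have "d (f q) (f y) \<le> C"
    proof (rule upper[OF boxq S'(1)])
      fix j assume j: "j \<le> m"
      have "\<bar>real (r j) - real (y j)\<bar> \<le> 1" using 2(2) j by (auto simp: near_def)
      moreover have "\<bar>real (q j) - real (r j)\<bar> \<le> 1" using r[OF j] by linarith
      ultimately show "\<bar>real (q j) - real (y j)\<bar> \<le> 2" by linarith
    qed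
    then have "S = S'"
      using disj[OF i] S S' unfolding R_disjoint_family_def by fastforce
    then have "start i q" using S S' boxq by (auto simp: start_def)
    then show False using no_start by simp
  qed
qed

text \<open>The spacing \<open>L\<close> of the births keeps different points at distance at least \<open>L\<close>, and the
  persistence at least \<open>2 * L\<close> keeps all of them at distance at least \<open>L\<close> from the diagonal.
  A coordinate in \<open>{0..L}\<close> can therefore not be matched more cheaply than with itself.\<close>

definition grid_point :: "nat \<Rightarrow> (nat \<Rightarrow> nat) \<Rightarrow> nat \<Rightarrow> dpoint" where
  "grid_point L x i = Off (Abs_offdiag (real i * real L, real i * real L + 2 * real L + real (x i)))"

definition grid_list :: "nat \<Rightarrow> nat \<Rightarrow> (nat \<Rightarrow> nat) \<Rightarrow> dpoint list" where
  "grid_list n L x = map (grid_point L x) [0..<n]"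

lemma Rep_grid:
  "0 < L \<Longrightarrow> Rep_offdiag (Abs_offdiag (real i * real L, real i * real L + 2 * real L + real k)) =
    (real i * real L, real i * real L + 2 * real L + real k)"
  by (rule Abs_offdiag_inverse) simp

lemma delta_grid_point:
  "0 < L \<Longrightarrow> delta (grid_point L x i) (grid_point L y i) = \<bar>real (x i) - real (y i)\<bar>"
  by (simp add: grid_point_def Rep_grid d_infty_def)

lemma delta_entry_grid_list_same:
  assumes "0 < L"
  shows "delta (entry (grid_list n L x) i) (entry (grid_list n L y) i) =
    (if i < n then \<bar>real (x i) - real (y i)\<bar> else 0)"
  using assms by (simp add: entry_def grid_list_def delta_grid_point)

lemma coordinate_le_delta:
  assumes "0 < L" "i < n" "x i \<le> L" "y i \<le> L"
  shows "\<bar>real (x i) - real (y i)\<bar> \<le> delta (entry (grid_list n L x) i) (entry (grid_list n L y) j)"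
proof -
  have xy: "\<bar>real (x i) - real (y i)\<bar> \<le> real L" using assms by linarith
  have x: "entry (grid_list n L x) i = grid_point L x i"
    using assms by (simp add: entry_def grid_list_def)
  consider "j = i" | "j < n" "j \<noteq> i" | "n \<le> j" by linarith
  then show ?thesis
  proof cases
    case 1
    then show ?thesis using assms by (simp add: delta_entry_grid_list_same)
  next
    case 2
    have "1 \<le> \<bar>real i - real j\<bar>" using 2(2) by linarith
    then have "1 * real L \<le> \<bar>real i - real j\<bar> * real L" by (intro mult_right_mono) auto
    also have "\<dots> = \<bar>real i * real L - real j * real L\<bar>"
      by (simp add: abs_mult flip: left_diff_distrib)
    finally have "real L \<le> \<bar>real i * real L - real j * real L\<bar>" by simp
    moreover have "entry (grid_list n L y) j = grid_point L y j"
      using 2 by (simp add: entry_def grid_list_def)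
    ultimately show ?thesis
      using xy assms(1) by (simp add: x grid_point_def Rep_grid d_infty_def)
  next
    case 3
    then have "entry (grid_list n L y) j = \<Delta>" by (simp add: entry_def grid_list_def)
    then have "delta (entry (grid_list n L x) i) (entry (grid_list n L y) j) = real L + real (x i) / 2"
      using assms(1) by (simp add: x grid_point_def Rep_grid)
    then show ?thesis using xy by simp
  qed
qed

text \<open>Every matching pays at least the coordinate difference at index \<open>i\<close>; the identity matching
  pays nothing outside the first \<open>n\<close> indices, which bounds the distance of neighbours.\<close>

lemma grid_list_bottleneck_bounds:
  assumes "0 < n" "0 < L" and x: "\<And>i. i < n \<Longrightarrow> x i \<le> L" and y: "\<And>i. i < n \<Longrightarrow> y i \<le> L"
  shows "i < n \<Longrightarrow> \<bar>real (x i) - real (y i)\<bar> \<le> bottleneck_list (grid_list n L x) (grid_list n L y)"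
    and "(\<And>i. i < n \<Longrightarrow> \<bar>real (x i) - real (y i)\<bar> \<le> 2) \<Longrightarrow>
      bottleneck_list (grid_list n L x) (grid_list n L y) \<le> 2"
proof -
  let ?z = "grid_list n L x" and ?w = "grid_list n L y"
  let ?c = "\<lambda>\<phi> i. delta (entry ?z i) (entry ?w (\<phi> i))"
  have len: "max (length ?z) (length ?w) = n" by (simp add: grid_list_def)
  have fin: "finite {\<phi>. \<phi> permutes {..<2 * n}}" by (simp add: finite_permutations)
  have id: "id \<in> {\<phi>. \<phi> permutes {..<2 * n}}" by (simp add: permutes_id)
  have B: "bottleneck_list ?z ?w =
      Min ((\<lambda>\<phi>. Max (?c \<phi> ` {..<2 * n})) ` {\<phi>. \<phi> permutes {..<2 * n}})"
    unfolding bottleneck_list_def len Let_def ..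
  {
    assume i: "i < n"
    have le: "\<bar>real (x i) - real (y i)\<bar> \<le> ?c \<phi> i" for \<phi>
      using coordinate_le_delta[of L i n x y] assms i by blast
    have "?c \<phi> i \<le> Max (?c \<phi> ` {..<2 * n})" for \<phi> using i by (intro Max_ge) auto
    then show "\<bar>real (x i) - real (y i)\<bar> \<le> bottleneck_list ?z ?w"
      unfolding B using fin id by (subst Min_ge_iff) (blast intro: order_trans[OF le])+
  next
    assume two: "\<And>i. i < n \<Longrightarrow> \<bar>real (x i) - real (y i)\<bar> \<le> 2"
    have c2: "?c id i \<le> 2" for i
      using two \<open>0 < L\<close> by (simp add: delta_entry_grid_list_same)
    have "bottleneck_list ?z ?w \<le> Max (?c id ` {..<2 * n})"
      unfolding B using fin id by (intro Min_le) blast+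
    also have "\<dots> \<le> 2" using \<open>0 < n\<close> c2 by (subst Max_le_iff) (auto simp: lessThan_empty_iff)
    finally show "bottleneck_list ?z ?w \<le> 2" .
  }
qed

text \<open>Comparing matchings in the same way bounds the Wasserstein distance. The upper bound is crude, since only
  its independence of \<open>L\<close> matters.\<close>

lemma grid_list_wasserstein_bounds:
  fixes p :: real
  assumes "0 < p" "0 < L" and x: "\<And>i. i < n \<Longrightarrow> x i \<le> L" and y: "\<And>i. i < n \<Longrightarrow> y i \<le> L"
  shows "i < n \<Longrightarrow> \<bar>real (x i) - real (y i)\<bar> \<le> wasserstein_list p (grid_list n L x) (grid_list n L y)"
    and "(\<And>i. i < n \<Longrightarrow> \<bar>real (x i) - real (y i)\<bar> \<le> 2) \<Longrightarrow>
      wasserstein_list p (grid_list n L x) (grid_list n L y) \<le> (real (2 * n) * 2 powr p) powr (1 / p)"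
proof -
  let ?z = "grid_list n L x" and ?w = "grid_list n L y"
  let ?c = "\<lambda>\<phi> i. delta (entry ?z i) (entry ?w (\<phi> i))"
  have len: "max (length ?z) (length ?w) = n" by (simp add: grid_list_def)
  have fin: "finite {\<phi>. \<phi> permutes {..<2 * n}}" by (simp add: finite_permutations)
  have id: "id \<in> {\<phi>. \<phi> permutes {..<2 * n}}" by (simp add: permutes_id)
  have W: "wasserstein_list p ?z ?w =
      Min ((\<lambda>\<phi>. (\<Sum>i<2 * n. ?c \<phi> i powr p) powr (1 / p)) ` {\<phi>. \<phi> permutes {..<2 * n}})"
    unfolding wasserstein_list_def len Let_def ..
  {
    assume i: "i < n"
    have le: "\<bar>real (x i) - real (y i)\<bar> \<le> ?c \<phi> i" for \<phi>
      using coordinate_le_delta[of L i n x y] assms i by blast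
    have "?c \<phi> i \<le> (\<Sum>i<2 * n. ?c \<phi> i powr p) powr (1 / p)" for \<phi>
    proof -
      have "?c \<phi> i = (?c \<phi> i powr p) powr (1 / p)"
        using \<open>0 < p\<close> by (simp add: powr_powr delta_nonneg)
      also have "\<dots> \<le> (\<Sum>i<2 * n. ?c \<phi> i powr p) powr (1 / p)"
        using i \<open>0 < p\<close> by (intro powr_mono2 member_le_sum) auto
      finally show ?thesis .
    qed
    then show "\<bar>real (x i) - real (y i)\<bar> \<le> wasserstein_list p ?z ?w"
      unfolding W using fin id by (subst Min_ge_iff) (blast intro: order_trans[OF le])+
  next
    assume two: "\<And>i. i < n \<Longrightarrow> \<bar>real (x i) - real (y i)\<bar> \<le> 2"
    have c2: "?c id i \<le> 2" for i
      using two \<open>0 < L\<close> by (simp add: delta_entry_grid_list_same)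
    have "wasserstein_list p ?z ?w \<le> (\<Sum>i<2 * n. ?c id i powr p) powr (1 / p)"
      unfolding W using fin id by (intro Min_le) blast+
    also have "\<dots> \<le> (\<Sum>i<2 * n. 2 powr p) powr (1 / p)"
      using c2 \<open>0 < p\<close> by (intro powr_mono2 sum_mono sum_nonneg) (auto simp: delta_nonneg)
    also have "\<dots> = (real (2 * n) * 2 powr p) powr (1 / p)" by simp
    finally show "wasserstein_list p ?z ?w \<le> (real (2 * n) * 2 powr p) powr (1 / p)" .
  }
qed

lemma same_diagram_grid_list: "0 < n \<Longrightarrow> same_diagram (grid_list n L x) (grid_list n L x)"
  by (auto simp: same_diagram_def grid_list_def)

theorem corollary2p13:
  fixes p :: real
  assumes "p > 1"
  shows "\<not> (\<exists>m. asdim_le (UNIV :: diagram set) bottleneck m) \<and>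
    \<not> (\<exists>m. asdim_le (UNIV :: diagram set) (wasserstein p) m)"
proof -
  have "\<not> asdim_le (UNIV :: diagram set) bottleneck m" for m
  proof (rule not_asdim_le_of_boxes[where C = 2])
    fix L :: nat assume "0 < L"
    then show "\<exists>f :: (nat \<Rightarrow> nat) \<Rightarrow> diagram. \<forall>x. (\<forall>i\<le>m. x i \<le> L) \<longrightarrow>
      f x \<in> UNIV \<and> (\<forall>y. (\<forall>i\<le>m. y i \<le> L) \<longrightarrow>
        (\<forall>i\<le>m. \<bar>real (x i) - real (y i)\<bar> \<le> bottleneck (f x) (f y)) \<and>
        ((\<forall>i\<le>m. \<bar>real (x i) - real (y i)\<bar> \<le> 2) \<longrightarrow> bottleneck (f x) (f y) \<le> 2))"
      by (intro exI[of _ "\<lambda>x. abs_diagram (grid_list (Suc m) L x)"])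
        (simp add: bottleneck.abs_eq same_diagram_grid_list grid_list_bottleneck_bounds less_Suc_eq_le)
  qed
  moreover have "\<not> asdim_le (UNIV :: diagram set) (wasserstein p) m" for m
  proof (rule not_asdim_le_of_boxes[where C = "(real (2 * Suc m) * 2 powr p) powr (1 / p)"])
    fix L :: nat assume "0 < L"
    then show "\<exists>f :: (nat \<Rightarrow> nat) \<Rightarrow> diagram. \<forall>x. (\<forall>i\<le>m. x i \<le> L) \<longrightarrow>
      f x \<in> UNIV \<and> (\<forall>y. (\<forall>i\<le>m. y i \<le> L) \<longrightarrow>
        (\<forall>i\<le>m. \<bar>real (x i) - real (y i)\<bar> \<le> wasserstein p (f x) (f y)) \<and>
        ((\<forall>i\<le>m. \<bar>real (x i) - real (y i)\<bar> \<le> 2) \<longrightarrow>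
          wasserstein p (f x) (f y) \<le> (real (2 * Suc m) * 2 powr p) powr (1 / p)))"
      using assms grid_list_wasserstein_bounds[of p L "Suc m"]
      by (intro exI[of _ "\<lambda>x. abs_diagram (grid_list (Suc m) L x)"])
        (simp add: wasserstein.abs_eq same_diagram_grid_list less_Suc_eq_le del: of_nat_Suc of_nat_mult)
  qed
  ultimately show ?thesis by blast
qed

end
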